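(* Let $n\ge 1$ and $N\ge 1$ be integers, let $S_N=\{r=(r_1,\dots,r_n)\in\mathbb{Z}^n : 1\le r_i\le N \text{ for } 1\le i\le n\}$, let $L=N^n$, and define $$\lambda_N=\max_{\|a\|_2=\|b\|_2=1}\ \sum_{r,s\in S_N,\ r\neq s}\frac{a_r b_s}{|r-s|^n},$$ the maximum being over real vectors $a=(a_r)_{r\in S_N}$, $b=(b_s)_{s\in S_N}$ in $\mathbb{R}^L$. Then for all $a,b\in\mathbb{R}^L$ $$\sum_{r,s\in S_N,\ r\neq s}\frac{a_r b_s}{|r-s|^n}\le \lambda_N\|a\|_2\|b\|_2 ,\qquad ( * )$$ and the following hold. (i) For fixed $n$, as $N\to\infty$, $|S^{n-1}|\ln N-o(\ln N)<\lambda_N<|S^{n-1}|\ln N+o(\ln N)$. (ii) For each $N$ there is exactly one pair $(\overline{a^N},\overline{b^N})$ with $\overline{a^N},\overline{b^N}\in\overline{\mathbb{R}_+^L}$ and $\|\overline{a^N}\|_2=\|\overline{b^N}\|_2=1$ such that equality holds in $( * )$ for $a=\overline{a^N}$, $b=\overline{b^N}$; this pair satisfies $\overline{a^N}=\overline{b^N}$, and $\overline{a^N}\in\mathbb{R}_+^L$.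
   Context: $|\cdot|$ on $\mathbb{R}^n$ is the Euclidean norm; $\|a\|_2=(\sum_{r} a_r^2)^{1/2}$. $|S^{n-1}|$ is the surface measure of the unit sphere in $\mathbb{R}^n$ (with $|S^0|=2$). Vectors in $\mathbb{R}^L$ are indexed by the $L=N^n$ points of $S_N$. $\mathbb{R}_+^L$ is the set of vectors all of whose entries are strictly positive, and $\overline{\mathbb{R}_+^L}$ is its closure, the set of vectors all of whose entries are nonnegative.
   Formalization: In (ii), "exactly one pair" is not claimed for n=1, N=2, where it is false: the form is a_1b_2+a_2b_1, λ_2=1, and every ((x,y),(y,x)) with x,y≥0, x²+y²=1 gives equality; there only the existence of an equality pair with equal, strictly positive components is stated. *)

theory Defs
  imports "HOL-Analysis.Analysis" "HOL-Library.Landau_Symbols"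
begin

text \<open>
  The dimension \<open>n\<close> is \<open>CARD('n)\<close> (automatically positive), points of \<open>\<int>\<^sup>n\<close> have type
  \<open>int ^ 'n\<close>, and vectors indexed by the grid are functions that are extensional on the grid,
  so that equality of vectors is equality of functions.
\<close>

definition grid :: "nat \<Rightarrow> (int ^ 'n) set" where
  "grid N = {r. \<forall>i. 1 \<le> r $ i \<and> r $ i \<le> int N}"

definition real_point :: "int ^ 'n \<Rightarrow> real ^ 'n" where
  "real_point r = (\<chi> i. real_of_int (r $ i))"

definition grid_vecs :: "nat \<Rightarrow> (int ^ 'n \<Rightarrow> real) set" where
  "grid_vecs N = grid N \<rightarrow>\<^sub>E UNIV"

definition pos_vecs :: "nat \<Rightarrow> (int ^ 'n \<Rightarrow> real) set" where
  "pos_vecs N = grid N \<rightarrow>\<^sub>E {0<..}"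

definition nonneg_vecs :: "nat \<Rightarrow> (int ^ 'n \<Rightarrow> real) set" where
  "nonneg_vecs N = grid N \<rightarrow>\<^sub>E {0..}"

definition grid_norm :: "nat \<Rightarrow> (int ^ 'n \<Rightarrow> real) \<Rightarrow> real" where
  "grid_norm N a = L2_set a (grid N)"

definition hls_form :: "nat \<Rightarrow> (int ^ 'n::finite \<Rightarrow> real) \<Rightarrow> (int ^ 'n \<Rightarrow> real) \<Rightarrow> real" where
  "hls_form N a b =
     (\<Sum>(r, s) \<in> {(r, s). r \<in> grid N \<and> s \<in> grid N \<and> r \<noteq> s}.
        a r * b s / norm (real_point r - real_point s) ^ CARD('n))"

text \<open>
  The maximum is taken literally as a greatest element. The type argument carries the
  dimension, which the result type does not mention.
\<close>

definition hls_const :: "'n::finite itself \<Rightarrow> nat \<Rightarrow> real" where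
  "hls_const _ N =
     (GREATEST x. \<exists>a \<in> grid_vecs N. \<exists>b \<in> grid_vecs N.
        grid_norm N a = 1 \<and> grid_norm N b = 1 \<and> x = hls_form N a (b :: int ^ 'n \<Rightarrow> real))"

definition extremal_pairs :: "nat \<Rightarrow> ((int ^ 'n::finite \<Rightarrow> real) \<times> (int ^ 'n \<Rightarrow> real)) set" where
  "extremal_pairs N =
     {(a, b). a \<in> nonneg_vecs N \<and> b \<in> nonneg_vecs N \<and> grid_norm N a = 1 \<and> grid_norm N b = 1 \<and>
        hls_form N a b = hls_const TYPE('n) N * grid_norm N a * grid_norm N b}"

text \<open>
  The libraries have no surface measure. On the unit sphere it is the measure of polar
  coordinates: the measure of \<open>E\<close> is the dimension times the Lebesgue measure of the cone over
  \<open>E\<close> inside the unit ball. In dimension one it is counting measure on \<open>{-1, 1}\<close>, so the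
  sphere has measure 2.
\<close>

definition sphere_surface_measure :: "'a::euclidean_space set \<Rightarrow> real" where
  "sphere_surface_measure E =
     real DIM('a) * measure lebesgue {t *\<^sub>R x | t x. 0 < t \<and> t \<le> 1 \<and> x \<in> E}"

end

theory Submission
  imports Defs "HOL-Real_Asymp.Real_Asymp"
begin

text \<open>
  The kernel \<open>1 / \<bar>r - s\<bar>\<^sup>n\<close> is symmetric, so by polarization the bilinear maximum is the maximum
  of the quadratic form, attained by compactness. Replacing a maximizer by its absolute value does
  not decrease the form, and maximizers are eigenvectors; since all off-diagonal entries are
  positive, nonnegative maximizers are strictly positive. If \<open>(a, b)\<close> is extremal, \<open>a - b\<close> is an
  eigenvector for \<open>-\<lambda>\<close>; were it nonzero, all products of two of its entries would be negative,
  which is impossible with three or more grid points. Likewise the difference of two extremal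
  vectors would have a strict sign, against equality of the norms.

  For the asymptotics, the row sums bound \<open>\<lambda>\<^sub>N\<close> from above (Schur test), and constant vectors
  bound it from below; the rows of points at distance more than \<open>M = \<lfloor>N / ln N\<rfloor>\<close> from the
  boundary contain the whole lattice ball of radius \<open>M\<close>, and these are almost all rows. Both bounds
  reduce to \<open>\<Sum> 1 / \<bar>k\<bar>\<^sup>n\<close> over the nonzero lattice points with \<open>\<bar>k\<bar> \<le> m\<close>, which is asymptotic to
  \<open>n V ln m\<close>, \<open>V\<close> the volume of the unit ball, because the ball of radius \<open>m\<close> contains about
  \<open>V m\<^sup>n\<close> lattice points.
\<close>

section \<open>Maximizers of a symmetric form with positive off-diagonal kernel\<close>

text \<open>A zero diagonal lets the sum over pairs of distinct points be treated as a full double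
  sum, the form of a symmetric matrix.\<close>

locale pos_kernel =
  fixes S :: "'i set" and K :: "'i \<Rightarrow> 'i \<Rightarrow> real"
  assumes finite_S: "finite S" and S_nonempty: "S \<noteq> {}"
    and sym: "K r s = K s r" and diag: "K r r = 0"
    and pos: "\<lbrakk>r \<in> S; s \<in> S; r \<noteq> s\<rbrakk> \<Longrightarrow> 0 < K r s"
begin

section \<open>The bilinear form, its matrix action and the squared norm\<close>

definition bform :: "('i \<Rightarrow> real) \<Rightarrow> ('i \<Rightarrow> real) \<Rightarrow> real" where
  "bform a b = (\<Sum>r\<in>S. \<Sum>s\<in>S. K r s * a r * b s)"

definition app :: "('i \<Rightarrow> real) \<Rightarrow> 'i \<Rightarrow> real" where
  "app a r = (\<Sum>s\<in>S. K r s * a s)"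

definition sq :: "('i \<Rightarrow> real) \<Rightarrow> real" where
  "sq a = (\<Sum>r\<in>S. (a r)\<^sup>2)"

lemma L2_set_square: "(L2_set a S)\<^sup>2 = sq a"
  by (simp add: L2_set_def sq_def sum_nonneg)

lemma L2_set_eq_1_iff: "L2_set a S = 1 \<longleftrightarrow> sq a = 1"
  by (simp add: L2_set_def sq_def)

lemma sq_nonneg: "0 \<le> sq a"
  by (simp add: sq_def sum_nonneg)

lemma sq_eq_0_iff: "sq a = 0 \<longleftrightarrow> (\<forall>r\<in>S. a r = 0)"
  using finite_S by (simp add: sq_def sum_nonneg_eq_0_iff)

lemma kernel_nonneg: "\<lbrakk>r \<in> S; s \<in> S\<rbrakk> \<Longrightarrow> 0 \<le> K r s"
  using pos[of r s] diag[of r] by (cases "r = s") auto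

lemma bform_eq_sum_app: "bform a b = (\<Sum>r\<in>S. a r * app b r)"
  by (simp add: bform_def app_def sum_distrib_left mult_ac)

lemma bform_commute: "bform a b = bform b a"
proof -
  have "bform a b = (\<Sum>s\<in>S. \<Sum>r\<in>S. K r s * a r * b s)"
    unfolding bform_def by (rule sum.swap)
  also have "\<dots> = bform b a"
    unfolding bform_def by (intro sum.cong refl) (simp add: sym mult_ac)
  finally show ?thesis .
qed

lemma bform_cong: "\<lbrakk>\<And>r. r \<in> S \<Longrightarrow> a r = a' r; \<And>r. r \<in> S \<Longrightarrow> b r = b' r\<rbrakk> \<Longrightarrow> bform a b = bform a' b'"
  by (auto simp: bform_def intro!: sum.cong)

lemma sq_cong: "(\<And>r. r \<in> S \<Longrightarrow> a r = a' r) \<Longrightarrow> sq a = sq a'"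
  by (auto simp: sq_def intro!: sum.cong)

lemma bform_scale: "bform (\<lambda>r. c * a r) (\<lambda>r. d * b r) = c * d * bform a b"
  by (simp add: bform_def sum_distrib_left mult_ac)

lemma sq_scale: "sq (\<lambda>r. c * a r) = c\<^sup>2 * sq a"
  by (simp add: sq_def sum_distrib_left power_mult_distrib)

lemma abs_bform_le: "\<bar>bform a b\<bar> \<le> bform (\<lambda>r. \<bar>a r\<bar>) (\<lambda>r. \<bar>b r\<bar>)"
proof -
  have "\<bar>bform a b\<bar> \<le> (\<Sum>r\<in>S. \<Sum>s\<in>S. \<bar>K r s * a r * b s\<bar>)"
    unfolding bform_def by (intro order.trans[OF sum_abs] sum_mono order.trans[OF sum_abs]) auto
  also have "\<dots> = bform (\<lambda>r. \<bar>a r\<bar>) (\<lambda>r. \<bar>b r\<bar>)"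
    unfolding bform_def by (intro sum.cong refl) (simp add: abs_mult kernel_nonneg)
  finally show ?thesis .
qed

text \<open>Polarization, by symmetry of the kernel. Bilinear bounds thus follow from bounding the
  quadratic form on both sides, not only from above.\<close>

lemma bform_parallelogram:
  "4 * bform a b = bform (\<lambda>r. a r + b r) (\<lambda>r. a r + b r) - bform (\<lambda>r. a r - b r) (\<lambda>r. a r - b r)"
proof -
  have "bform (\<lambda>r. a r + b r) (\<lambda>r. a r + b r) - bform (\<lambda>r. a r - b r) (\<lambda>r. a r - b r)
      = 2 * bform a b + 2 * bform b a"
    unfolding bform_def sum_distrib_left sum.distrib[symmetric] sum_subtractf[symmetric]
    by (intro sum.cong refl) (simp add: algebra_simps)
  then show ?thesis by (simp add: bform_commute[of b a])
qed

lemma sq_parallelogram: "sq (\<lambda>r. a r + b r) + sq (\<lambda>r. a r - b r) = 2 * sq a + 2 * sq b"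
  unfolding sq_def sum_distrib_left sum.distrib[symmetric]
  by (intro sum.cong refl) (simp add: power2_eq_square algebra_simps)

section \<open>Existence of a nonnegative maximizer\<close>

lemma quadratic_form_attains_max:
  "\<exists>v\<in>S \<rightarrow>\<^sub>E UNIV. sq v = 1 \<and> (\<forall>w. sq w = 1 \<longrightarrow> bform w w \<le> bform v v)"
proof -
  \<comment> \<open>Compactness is argued in the product over \<open>S\<close>, whose points are the
    extensional vectors: the unit sphere is closed there and lies in a cube, compact by Tychonoff's
    theorem.\<close>
  define X where "X = product_topology (\<lambda>_::'i. euclideanreal) S"
  have top: "topspace X = S \<rightarrow>\<^sub>E UNIV" by (simp add: X_def)
  have proj: "continuous_map X euclideanreal (\<lambda>x. x r)" if "r \<in> S" for r
    unfolding X_def using that by (rule continuous_map_product_projection)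
  have cq: "continuous_map X euclideanreal (\<lambda>x. bform x x)"
    unfolding bform_def using finite_S
    by (intro continuous_intros proj) auto
  have cs: "continuous_map X euclideanreal sq"
    unfolding sq_def[abs_def] using finite_S
    by (intro continuous_intros proj) auto
  define C where "C = {x \<in> topspace X. sq x \<in> {1}}"
  have "closedin X C" unfolding C_def
    by (rule closedin_continuous_map_preimage[OF cs]) simp
  moreover have "compactin X (S \<rightarrow>\<^sub>E {-1..1})"
    unfolding X_def compactin_PiE by auto
  moreover have "C \<subseteq> S \<rightarrow>\<^sub>E {-1..1}"
  proof
    fix x assume x: "x \<in> C"
    have "x r \<in> {-1..1}" if "r \<in> S" for r
    proof -
      have "(x r)\<^sup>2 \<le> sq x" unfolding sq_def using finite_S that
        by (intro member_le_sum) auto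
      then have "\<bar>x r\<bar> \<le> 1" using x by (simp add: C_def abs_square_le_1)
      then show ?thesis by auto
    qed
    then show "x \<in> S \<rightarrow>\<^sub>E {-1..1}" using x by (auto simp: C_def top PiE_def)
  qed
  ultimately have "compactin X C" using closed_compactin by blast
  then have "compact ((\<lambda>x. bform x x) ` C)"
    using image_compactin[OF _ cq] by simp
  moreover obtain r0 where r0: "r0 \<in> S" using S_nonempty by auto
  have "(\<lambda>r\<in>S. if r = r0 then 1 else 0) \<in> C"
    using r0 finite_S by (simp add: C_def top sq_def sum.delta if_distrib[of "\<lambda>x. x\<^sup>2"] cong: if_cong)
  ultimately obtain v where v: "v \<in> C" "\<And>w. w \<in> C \<Longrightarrow> bform w w \<le> bform v v"
    using compact_attains_sup[of "(\<lambda>x. bform x x) ` C"] by blast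
  \<comment> \<open>\<open>w\<close> need not be extensional; restricting it to \<open>S\<close>
    changes neither the form nor the norm.\<close>
  have "bform w w \<le> bform v v" if "sq w = 1" for w
  proof -
    have "bform w w = bform (restrict w S) (restrict w S)" "sq w = sq (restrict w S)"
      by (auto intro: bform_cong sq_cong)
    then show ?thesis using v(2)[of "restrict w S"] that by (auto simp: C_def top)
  qed
  then show ?thesis using v(1) by (auto simp: C_def top)
qed

lemma quadratic_form_maximizer_bound:
  assumes "\<And>w. sq w = 1 \<Longrightarrow> bform w w \<le> \<mu>"
  shows "bform w w \<le> \<mu> * sq w"
proof (cases "sq w = 0")
  case True
  then have "bform w w = 0" by (simp add: sq_eq_0_iff bform_def)
  then show ?thesis using True by simp
next
  case False
  then have p: "sq w > 0" using sq_nonneg[of w] by simp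
  let ?c = "1 / sqrt (sq w)"
  have "sq (\<lambda>r. ?c * w r) = 1"
    unfolding sq_scale using p by (simp add: power_divide)
  then have "bform (\<lambda>r. ?c * w r) (\<lambda>r. ?c * w r) \<le> \<mu>" using assms by blast
  then show ?thesis unfolding bform_scale using p by (simp add: field_simps)
qed

text \<open>Taking absolute values keeps a maximizer of the quadratic form maximal. The quadratic
  bound holds for the negated form as well, and polarization extends it to pairs.\<close>

lemma exists_maximizer:
  "\<exists>v\<in>S \<rightarrow>\<^sub>E {0..}. sq v = 1 \<and> (\<forall>a b. bform a b \<le> bform v v * L2_set a S * L2_set b S)"
proof -
  obtain u where u: "u \<in> S \<rightarrow>\<^sub>E UNIV" "sq u = 1" "\<And>w. sq w = 1 \<Longrightarrow> bform w w \<le> bform u u"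
    using quadratic_form_attains_max by blast
  define v where "v = (\<lambda>r\<in>S. \<bar>u r\<bar>)"
  have sv: "sq v = 1" using u(2) by (simp add: v_def sq_def)
  have "bform v v = bform (\<lambda>r. \<bar>u r\<bar>) (\<lambda>r. \<bar>u r\<bar>)" by (auto simp: v_def intro: bform_cong)
  then have "bform u u \<le> bform v v" using abs_bform_le[of u u] by linarith
  then have "bform w w \<le> bform v v" if "sq w = 1" for w using u(3)[OF that] by linarith
  then have q: "bform w w \<le> bform v v * sq w" for w
    by (rule quadratic_form_maximizer_bound)
  \<comment> \<open>The lowest value of the form is no larger in modulus than its maximum: pass to
    the absolute value, which has the same norm.\<close>
  have q': "- bform w w \<le> bform v v * sq w" for w
    using abs_bform_le[of w w] q[of "\<lambda>r. \<bar>w r\<bar>"] by (simp add: sq_def)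
  have b: "2 * bform a b \<le> bform v v * (sq a + sq b)" for a b
  proof -
    have "4 * bform a b \<le> bform v v * (sq (\<lambda>r. a r + b r) + sq (\<lambda>r. a r - b r))"
      unfolding bform_parallelogram
      using q[of "\<lambda>r. a r + b r"] q'[of "\<lambda>r. a r - b r"] by (simp add: algebra_simps)
    then show ?thesis unfolding sq_parallelogram by (simp add: algebra_simps)
  qed
  have "bform a b \<le> bform v v * L2_set a S * L2_set b S" for a b
  proof (cases "sq a = 0 \<or> sq b = 0")
    case True
    then have "bform a b = 0" by (auto simp: sq_eq_0_iff bform_def)
    moreover have "L2_set a S = 0 \<or> L2_set b S = 0" using True by (auto simp: L2_set_square[symmetric])
    ultimately show ?thesis by auto
  next
    case False
    let ?\<alpha> = "L2_set a S" and ?\<beta> = "L2_set b S"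
    have p: "?\<alpha> > 0" "?\<beta> > 0" using False
      by (auto simp: L2_set_square[symmetric] order_less_le)
    have "sq (\<lambda>r. 1/?\<alpha> * a r) = 1" "sq (\<lambda>r. 1/?\<beta> * b r) = 1"
      unfolding sq_scale L2_set_square[symmetric] using p by (simp_all add: power_divide)
    then have "bform (\<lambda>r. 1/?\<alpha> * a r) (\<lambda>r. 1/?\<beta> * b r) \<le> bform v v"
      using b[of "\<lambda>r. 1/?\<alpha> * a r" "\<lambda>r. 1/?\<beta> * b r"] by simp
    then show ?thesis unfolding bform_scale using p by (simp add: field_simps)
  qed
  then show ?thesis using sv by (intro bexI[of _ v]) (auto simp: v_def)
qed

section \<open>Extremal pairs as eigenvectors, and their rigidity\<close>

text \<open>Testing the bound with \<open>app b\<close> in the first slot gives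
  \<open>sq (app b) \<le> lam\<^sup>2 * sq b\<close>. Expanding the squared norm of
  \<open>app b - lam * a\<close> then leaves at most \<open>lam\<^sup>2 * sq b - 2 * lam\<^sup>2 *
  sq b + lam\<^sup>2 * sq b\<close>, that is 0.\<close>

lemma extremal_imp_eigenvector:
  assumes bound: "\<And>a b. bform a b \<le> lam * L2_set a S * L2_set b S"
    and sqs: "sq a = sq b" and ext: "bform a b = lam * sq b" and r: "r \<in> S"
  shows "app b r = lam * a r"
proof -
  have nn: "sq (app b) = bform (app b) b" by (simp add: bform_eq_sum_app sq_def power2_eq_square)
  have "sq (app b) \<le> lam\<^sup>2 * sq b"
  proof (cases "sq (app b) = 0")
    case False
    then have p: "L2_set (app b) S > 0" by (auto simp: L2_set_square[symmetric] order_less_le)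
    have "(L2_set (app b) S)\<^sup>2 \<le> lam * L2_set (app b) S * L2_set b S"
      using bound[of "app b" b] by (simp add: L2_set_square nn)
    then have "L2_set (app b) S \<le> lam * L2_set b S"
      using p by (simp add: power2_eq_square mult.left_commute)
    then have "(L2_set (app b) S)\<^sup>2 \<le> (lam * L2_set b S)\<^sup>2"
      using p by (intro power_mono) auto
    then show ?thesis by (simp add: power_mult_distrib L2_set_square)
  qed (simp add: sq_nonneg)
  moreover have "sq (\<lambda>r. app b r - lam * a r) = sq (app b) - 2 * lam * bform a b + lam\<^sup>2 * sq a"
    unfolding sq_def bform_eq_sum_app sum_distrib_left sum.distrib[symmetric] sum_subtractf[symmetric]
    by (intro sum.cong refl) (simp add: power2_eq_square algebra_simps)
  ultimately have "sq (\<lambda>r. app b r - lam * a r) \<le> 0"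
    using ext sqs by (simp add: power2_eq_square)
  then have "sq (\<lambda>r. app b r - lam * a r) = 0" using sq_nonneg[of "\<lambda>r. app b r - lam * a r"] by linarith
  then show ?thesis using r by (simp add: sq_eq_0_iff)
qed

text \<open>Perron's argument: one positive entry feeds every other row through a positive kernel
  entry, so \<open>lam * w r\<close> is positive there and \<open>w r\<close> cannot vanish.\<close>

lemma nonneg_eigenvector_pos:
  assumes nn: "\<And>r. r \<in> S \<Longrightarrow> 0 \<le> w r" and eig: "\<And>r. r \<in> S \<Longrightarrow> app w r = lam * w r"
    and nz: "sq w \<noteq> 0" and r: "r \<in> S"
  shows "0 < w r"
proof -
  obtain t where t: "t \<in> S" "w t \<noteq> 0" using nz sq_eq_0_iff by blast
  then have tp: "w t > 0" using nn[of t] by simp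
  show ?thesis
  proof (cases "t = r")
    case False
    have "0 < K r t * w t" using pos[of r t] t r False tp by simp
    also have "\<dots> \<le> app w r" unfolding app_def using finite_S t(1) r
      by (intro member_le_sum[of t S "\<lambda>s. K r s * w s"]) (auto simp: nn kernel_nonneg)
    finally show ?thesis using eig[OF r] nn[OF r] by (cases "w r = 0") auto
  qed (use tp in auto)
qed

text \<open>
  If \<open>\<bar>w\<bar>\<close> did better than \<open>w\<close>, it would beat the maximum; so \<open>\<bar>w\<bar>\<close> is extremal too, and no
  cancellation takes place in the form at \<open>w\<close>.
\<close>

lemma abs_extremal:
  assumes bound: "\<And>a b. bform a b \<le> lam * L2_set a S * L2_set b S"
    and \<sigma>: "\<bar>\<sigma>\<bar> = 1" and ext: "bform w w = \<sigma> * (lam * sq w)" and nz: "sq w \<noteq> 0"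
  shows "r \<in> S \<Longrightarrow> w r \<noteq> 0"
    and "\<lbrakk>r \<in> S; s \<in> S; r \<noteq> s\<rbrakk> \<Longrightarrow> 0 < \<sigma> * (w r * w s)"
proof -
  let ?v = "\<lambda>r. \<bar>w r\<bar>"
  have sv: "sq ?v = sq w" by (simp add: sq_def)
  have \<sigma>': "\<sigma> * \<sigma> = 1" using \<sigma> by (metis abs_mult_self_eq mult_1)
  have "bform ?v ?v \<le> lam * sq w"
    using bound[of ?v ?v] L2_set_square[of ?v] by (simp add: sv mult.assoc power2_eq_square)
  moreover have "\<sigma> * bform w w = lam * sq w" unfolding ext using \<sigma>' by (simp flip: mult.assoc)
  moreover have "\<sigma> * bform w w \<le> bform ?v ?v"
    using abs_bform_le[of w w] \<sigma> by (metis abs_le_D1 abs_mult mult_1)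
  ultimately have eq: "bform ?v ?v = lam * sq w" "\<sigma> * bform w w = bform ?v ?v" by linarith+
  have "app ?v r = lam * ?v r" if "r \<in> S" for r
    using extremal_imp_eigenvector[of lam ?v ?v r] bound eq(1) sv that by simp
  then have pv: "0 < ?v r" if "r \<in> S" for r
    using nonneg_eigenvector_pos[of ?v lam r] nz that sv by auto
  then show *: "w r \<noteq> 0" if "r \<in> S" for r using that by fastforce
  \<comment> \<open>The forms at \<open>w\<close> and at its absolute value agree up to the sign
    \<open>\<sigma>\<close>, so these nonnegative terms add up to 0 and each of them is 0.\<close>
  have "0 = (\<Sum>r\<in>S. \<Sum>s\<in>S. K r s * (\<bar>w r\<bar> * \<bar>w s\<bar> - \<sigma> * (w r * w s)))"
    using eq(2) unfolding bform_def
    by (simp add: right_diff_distrib sum_subtractf sum_distrib_left mult_ac)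
  also have "\<dots> = (\<Sum>(r,s)\<in>S\<times>S. K r s * (\<bar>w r\<bar> * \<bar>w s\<bar> - \<sigma> * (w r * w s)))"
    by (rule sum.cartesian_product)
  finally have z: "(\<Sum>(r,s)\<in>S\<times>S. K r s * (\<bar>w r\<bar> * \<bar>w s\<bar> - \<sigma> * (w r * w s))) = 0" by simp
  have nn: "0 \<le> \<bar>w r\<bar> * \<bar>w s\<bar> - \<sigma> * (w r * w s)" for r s
    using abs_ge_self[of "\<sigma> * (w r * w s)"] by (simp add: abs_mult \<sigma>)
  show "0 < \<sigma> * (w r * w s)" if rs: "r \<in> S" "s \<in> S" "r \<noteq> s"
  proof -
    have "\<forall>p\<in>S\<times>S. (case p of (r,s) \<Rightarrow> K r s * (\<bar>w r\<bar> * \<bar>w s\<bar> - \<sigma> * (w r * w s))) = 0"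
      using z finite_S nn by (subst (asm) sum_nonneg_eq_0_iff) (auto simp: kernel_nonneg)
    then have "K r s * (\<bar>w r\<bar> * \<bar>w s\<bar> - \<sigma> * (w r * w s)) = 0" using rs by auto
    then have "\<sigma> * (w r * w s) = \<bar>w r\<bar> * \<bar>w s\<bar>" using pos[of r s] rs by auto
    also have "\<dots> > 0" using * rs by simp
    finally show ?thesis .
  qed
qed

text \<open>Three points are essential: on two points with kernel 1, the vectors
  \<open>(1, 0)\<close> and \<open>(0, 1)\<close> form an extremal pair with \<open>lam = 1\<close>.
  The difference of an extremal pair is an eigenvector for \<open>- lam\<close>, so
  \<open>abs_extremal\<close> is used with sign -1.\<close>

lemma extremal_pair_diagonal:
  assumes bound: "\<And>a b. bform a b \<le> lam * L2_set a S * L2_set b S"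
    and card: "3 \<le> card S"
    and ab: "sq a = 1" "sq b = 1" "bform a b = lam" and r: "r \<in> S"
  shows "a r = b r"
proof (rule ccontr)
  assume ne: "a r \<noteq> b r"
  let ?w = "\<lambda>r. a r - b r"
  have nz: "sq ?w \<noteq> 0" using ne r by (auto simp: sq_eq_0_iff)
  have e: "app b r = lam * a r" "app a r = lam * b r" if "r \<in> S" for r
    using extremal_imp_eigenvector[of lam a b r] extremal_imp_eigenvector[of lam b a r]
      bound ab that by (simp_all add: bform_commute)
  have "app ?w r = - lam * ?w r" if "r \<in> S" for r
    using e[OF that] by (simp add: app_def right_diff_distrib sum_subtractf algebra_simps)
  then have "bform ?w ?w = (-1) * (lam * sq ?w)"
    unfolding bform_eq_sum_app sq_def sum_distrib_left
    by (intro sum.cong refl) (simp add: power2_eq_square mult.left_commute del: mult_minus_left)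
  note ext = abs_extremal(2)[OF bound _ this nz]
  obtain T where "T \<subseteq> S" "card T = 3" using card by (meson obtain_subset_with_card_n)
  then obtain x y z where xyz: "x \<in> S" "y \<in> S" "z \<in> S" "x \<noteq> y" "x \<noteq> z" "y \<noteq> z"
    by (auto simp: card_3_iff)
  \<comment> \<open>Of three nonzero reals two share a sign, so the three products cannot all be
    negative.\<close>
  have "?w x * ?w y < 0" "?w x * ?w z < 0" "?w y * ?w z < 0"
    using ext[of x y] ext[of x z] ext[of y z] xyz by auto
  then show False by (auto simp: mult_less_0_iff)
qed

text \<open>The difference is an eigenvector for \<open>lam\<close>; \<open>abs_extremal\<close>
  with sign 1 gives it one strict sign on \<open>S\<close>. Then one of the nonnegative vectors lies
  strictly below the other everywhere and has the smaller norm.\<close>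

lemma extremal_vector_unique:
  assumes bound: "\<And>a b. bform a b \<le> lam * L2_set a S * L2_set b S"
    and a: "sq a = 1" "bform a a = lam" "\<And>r. r \<in> S \<Longrightarrow> 0 \<le> a r"
    and b: "sq b = 1" "bform b b = lam" "\<And>r. r \<in> S \<Longrightarrow> 0 \<le> b r"
    and r: "r \<in> S"
  shows "a r = b r"
proof (rule ccontr)
  assume ne: "a r \<noteq> b r"
  let ?w = "\<lambda>r. a r - b r"
  have nz: "sq ?w \<noteq> 0" using ne r by (auto simp: sq_eq_0_iff)
  have e: "app a r = lam * a r" "app b r = lam * b r" if "r \<in> S" for r
    using extremal_imp_eigenvector[of lam a a r] extremal_imp_eigenvector[of lam b b r]
      bound a b that by simp_all
  have "app ?w r = lam * ?w r" if "r \<in> S" for r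
    using e[OF that] by (simp add: app_def right_diff_distrib sum_subtractf)
  then have "bform ?w ?w = 1 * (lam * sq ?w)"
    unfolding bform_eq_sum_app sq_def sum_distrib_left
    by (intro sum.cong refl) (simp add: power2_eq_square)
  note ext = abs_extremal(2)[OF bound _ this nz]
  have same: "0 < ?w r * ?w s" if "s \<in> S" for s
    using ext[of r s] that r ne by (cases "r = s") (auto simp: zero_less_mult_iff)
  have sqlt: "sq x < sq y" if "\<And>s. s \<in> S \<Longrightarrow> 0 \<le> x s \<and> x s < y s" for x y
    unfolding sq_def using finite_S S_nonempty that
    by (intro sum_strict_mono power_strict_mono) auto
  show False
  proof (cases "a r < b r")
    case True
    then have "a s < b s" if "s \<in> S" for s using same[OF that] by (auto simp: zero_less_mult_iff)
    then show False using sqlt[of a b] a b by auto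
  next
    case False
    then have "b s < a s" if "s \<in> S" for s using same[OF that] ne by (auto simp: zero_less_mult_iff)
    then show False using sqlt[of b a] a b by auto
  qed
qed

text \<open>Each product is bounded by half the sum of two squares; by symmetry of the kernel the
  two resulting double sums coincide, and the row sums control them.\<close>

lemma schur_test:
  assumes row: "\<And>r. r \<in> S \<Longrightarrow> (\<Sum>s\<in>S. K r s) \<le> R"
  shows "bform a a \<le> R * sq a"
proof -
  have "bform a a \<le> (\<Sum>r\<in>S. \<Sum>s\<in>S. K r s * ((a r)\<^sup>2 + (a s)\<^sup>2) / 2)"
    unfolding bform_def
  proof (intro sum_mono)
    fix r s assume rs: "r \<in> S" "s \<in> S"
    have "K r s * (2 * (a r * a s)) \<le> K r s * ((a r)\<^sup>2 + (a s)\<^sup>2)"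
      using sum_squares_bound[of "a r" "a s"] rs by (intro mult_left_mono) (auto simp: kernel_nonneg mult.assoc)
    then show "K r s * a r * a s \<le> K r s * ((a r)\<^sup>2 + (a s)\<^sup>2) / 2" by (simp add: mult_ac)
  qed
  also have "\<dots> = (\<Sum>r\<in>S. \<Sum>s\<in>S. K r s * (a r)\<^sup>2) / 2 + (\<Sum>r\<in>S. \<Sum>s\<in>S. K r s * (a s)\<^sup>2) / 2"
    by (simp add: sum_divide_distrib sum.distrib distrib_left add_divide_distrib)
  also have "(\<Sum>r\<in>S. \<Sum>s\<in>S. K r s * (a s)\<^sup>2) = (\<Sum>s\<in>S. \<Sum>r\<in>S. K r s * (a s)\<^sup>2)"
    by (rule sum.swap)
  also have "\<dots> = (\<Sum>r\<in>S. \<Sum>s\<in>S. K r s * (a r)\<^sup>2)"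
    by (intro sum.cong refl) (simp add: sym)
  also have "(\<Sum>r\<in>S. \<Sum>s\<in>S. K r s * (a r)\<^sup>2) = (\<Sum>r\<in>S. (\<Sum>s\<in>S. K r s) * (a r)\<^sup>2)"
    by (simp add: sum_distrib_right)
  also have "\<dots> \<le> (\<Sum>r\<in>S. R * (a r)\<^sup>2)"
    by (intro sum_mono mult_right_mono row) auto
  finally show ?thesis by (simp add: sq_def sum_distrib_left)
qed

end

section \<open>Sums over lattice balls\<close>

text \<open>Beyond some index the increments of \<open>a - l * b\<close> are at most
  \<open>e / 2\<close> times those of \<open>b\<close>. Telescoping carries this over to the
  sequences, and the growth of \<open>b\<close> absorbs the initial error.\<close>

lemma stolz_cesaro:
  fixes a b :: "nat \<Rightarrow> real"
  assumes inc: "\<And>n. b n < b (Suc n)" and top: "filterlim b at_top sequentially"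
    and lim: "(\<lambda>n. (a (Suc n) - a n) / (b (Suc n) - b n)) \<longlonglongrightarrow> l"
  shows "(\<lambda>n. a n / b n) \<longlonglongrightarrow> l"
proof (rule LIMSEQ_I)
  fix e :: real assume e: "e > 0"
  obtain M where M: "\<And>n. n \<ge> M \<Longrightarrow> \<bar>(a (Suc n) - a n) / (b (Suc n) - b n) - l\<bar> < e / 2"
    using LIMSEQ_D[OF lim, of "e/2"] e by auto
  have diff: "\<bar>(a (Suc n) - l * b (Suc n)) - (a n - l * b n)\<bar> \<le> e / 2 * (b (Suc n) - b n)"
    if "n \<ge> M" for n
  proof -
    have p: "b (Suc n) - b n > 0" using inc[of n] by simp
    have "(a (Suc n) - l * b (Suc n)) - (a n - l * b n)
        = ((a (Suc n) - a n) / (b (Suc n) - b n) - l) * (b (Suc n) - b n)"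
      using p by (simp add: field_simps)
    then show ?thesis using M[OF that] p by (simp add: abs_mult)
  qed
  have tel: "\<bar>(a n - l * b n) - (a M - l * b M)\<bar> \<le> e / 2 * (b n - b M)" if "n \<ge> M" for n
    using that
  proof (induction n rule: dec_induct)
    case (step n)
    have "e / 2 * (b (Suc n) - b M) = e / 2 * (b (Suc n) - b n) + e / 2 * (b n - b M)"
      using distrib_left[of "e / 2" "b (Suc n) - b n" "b n - b M"] by simp
    then show ?case using diff[OF step.hyps(1)] step.IH by linarith
  qed simp
  \<comment> \<open>\<open>D\<close> gathers the terms at index \<open>M\<close>; once
    \<open>b n > 2 * D / e\<close> they cost less than the remaining \<open>e / 2\<close>.\<close>
  define D where "D = \<bar>a M - l * b M\<bar> + e / 2 * \<bar>b M\<bar>"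
  have "eventually (\<lambda>n. b n > 2 * D / e \<and> b n > 0) sequentially"
    using top by (auto simp: filterlim_at_top_dense eventually_conj)
  then obtain M' where M': "\<And>n. n \<ge> M' \<Longrightarrow> b n > 2 * D / e \<and> b n > 0"
    by (auto simp: eventually_sequentially)
  have "norm (a n / b n - l) < e" if n: "n \<ge> max M M'" for n
  proof -
    have b: "b n > 0" "D < e / 2 * b n" using M'[of n] n e by (auto simp: field_simps)
    have "\<bar>a n - l * b n\<bar> \<le> \<bar>a M - l * b M\<bar> + e / 2 * (b n - b M)" using tel[of n] n by linarith
    also have "\<dots> \<le> D + e / 2 * b n"
      unfolding D_def using e abs_ge_minus_self[of "b M"]
      by (simp add: right_diff_distrib) (metis abs_ge_minus_self abs_mult abs_of_pos)
    also have "\<dots> < e * b n" using b by simp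
    finally have "\<bar>(a n - l * b n) / b n\<bar> < e" using b by (simp add: abs_divide field_simps)
    moreover have "a n / b n - l = (a n - l * b n) / b n" using b by (simp add: field_simps)
    ultimately show ?thesis by simp
  qed
  then show "\<exists>no. \<forall>n\<ge>no. norm (a n / b n - l) < e" by blast
qed

text \<open>Source of the factor n in the constant: the decrease of \<open>1 / m ^ n\<close> from
  \<open>m\<close> to \<open>m + 1\<close>, relative to its value, is about
  \<open>n / m\<close>.\<close>

lemma power_ratio_limit: 
   "(\<lambda>m. real m * (1 - (real m / (real m + 1)) ^ n)) \<longlonglongrightarrow> real n"
  by real_asymp

lemma power_shift_ratio_limit: 
   "(\<lambda>m. ((real m + c) / real m) ^ n) \<longlonglongrightarrow> 1"
  by real_asymp

section \<open>Integer boxes and norms of integer points\<close>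

lemma card_int_box:
  "card {r :: int ^ 'n. \<forall>i. lo \<le> r $ i \<and> r $ i \<le> hi} = nat (hi - lo + 1) ^ CARD('n)"
proof -
  have "bij_betw (\<lambda>r i. r $ i) {r :: int ^ 'n. \<forall>i. lo \<le> r $ i \<and> r $ i \<le> hi} (UNIV \<rightarrow>\<^sub>E {lo..hi})"
    by (rule bij_betw_byWitness[of _ "vec_lambda"]) auto
  then have "card {r :: int ^ 'n. \<forall>i. lo \<le> r $ i \<and> r $ i \<le> hi} = card ((UNIV::'n set) \<rightarrow>\<^sub>E {lo..hi})"
    by (rule bij_betw_same_card)
  then show ?thesis by (simp add: card_PiE)
qed

lemma finite_int_box: "finite {r :: int ^ 'n. \<forall>i. lo \<le> r $ i \<and> r $ i \<le> hi}"
proof -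
  have "bij_betw (\<lambda>r i. r $ i) {r :: int ^ 'n. \<forall>i. lo \<le> r $ i \<and> r $ i \<le> hi} (UNIV \<rightarrow>\<^sub>E {lo..hi})"
    by (rule bij_betw_byWitness[of _ "vec_lambda"]) auto
  then show ?thesis by (simp add: bij_betw_finite finite_PiE)
qed

lemma real_point_diff: "real_point (r - s) = real_point r - real_point s"
  by (simp add: real_point_def vec_eq_iff)

lemma real_point_0 [simp]: "real_point 0 = 0"
  by (simp add: real_point_def vec_eq_iff)

lemma abs_le_norm_real_point: "real_of_int \<bar>r $ i\<bar> \<le> norm (real_point r)"
  using component_le_norm_cart[of "real_point r" i] by (simp add: real_point_def)

lemma norm_real_point_ge_1:
  assumes "r \<noteq> 0" shows "1 \<le> norm (real_point r)"
proof -
  obtain i where "r $ i \<noteq> 0" using assms by (auto simp: vec_eq_iff)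
  then have "(1::real) \<le> real_of_int \<bar>r $ i\<bar>" by linarith
  then show ?thesis using abs_le_norm_real_point[of r i] by linarith
qed

section \<open>Counting lattice points by volume\<close>

definition lattice_ball :: "nat \<Rightarrow> (int ^ 'n) set" where
  "lattice_ball m = {k. norm (real_point k) \<le> real m}"

lemma finite_lattice_ball: "finite (lattice_ball m)"
proof (rule finite_subset)
  show "lattice_ball m \<subseteq> {r. \<forall>i. - int m \<le> r $ i \<and> r $ i \<le> int m}"
  proof
    fix k :: "int ^ 'n" assume k: "k \<in> lattice_ball m"
    have "\<bar>k $ i\<bar> \<le> int m" for i
      using abs_le_norm_real_point[of k i] k by (simp add: lattice_ball_def)
    then show "k \<in> {r. \<forall>i. - int m \<le> r $ i \<and> r $ i \<le> int m}" by (simp add: abs_le_iff) (smt (verit))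
  qed
qed (rule finite_int_box)

text \<open>Cubes of side 1 around the lattice points cover the space and overlap only in null sets,
  so counting points becomes measuring unions of cubes.\<close>

definition unit_cell :: "int ^ 'n \<Rightarrow> (real ^ 'n) set" where
  "unit_cell k = cbox (real_point k - (\<chi> i. 1/2)) (real_point k + (\<chi> i. 1/2))"

lemma measure_unit_cell: "measure lebesgue (unit_cell k) = 1"
  unfolding unit_cell_def using content_cbox_cart[of "real_point k - (\<chi> i. 1/2)" "real_point k + (\<chi> i. 1/2)"]
  by (auto simp: interval_ne_empty_cart)

text \<open>The bound through the l1 norm is crude; any fixed bound only shifts radii by a
  constant.\<close>

lemma norm_diff_unit_cell:
  fixes k :: "int ^ 'n"
  assumes "x \<in> unit_cell k" shows "norm (x - real_point k) \<le> real CARD('n)"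
proof -
  have "\<bar>(x - real_point k) $ i\<bar> \<le> 1" for i
    using assms unfolding unit_cell_def mem_box_cart by (simp add: abs_le_iff) (smt (verit) field_sum_of_halves)
  then have "(\<Sum>i\<in>UNIV. \<bar>(x - real_point k) $ i\<bar>) \<le> (\<Sum>i\<in>(UNIV::'n set). 1)" by (intro sum_mono) auto
  then show ?thesis using norm_le_l1_cart[of "x - real_point k"] by simp
qed

lemma exists_unit_cell: "\<exists>k. x \<in> unit_cell k"
proof
  show "x \<in> unit_cell (\<chi> i. round (x $ i))"
    unfolding unit_cell_def mem_box_cart real_point_def
    using of_int_round_ge of_int_round_le by (auto simp: algebra_simps)
qed

lemma interiors_unit_cells_disjoint:
  assumes "k \<noteq> l"
  shows "interior (unit_cell k) \<inter> interior (unit_cell l) = {}"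
proof -
  obtain i where i: "k $ i \<noteq> l $ i" using assms by (auto simp: vec_eq_iff)
  have False if "x \<in> interior (unit_cell k)" "x \<in> interior (unit_cell l)" for x
  proof -
    have "\<bar>x $ i - real_of_int (k $ i)\<bar> < 1/2" "\<bar>x $ i - real_of_int (l $ i)\<bar> < 1/2"
      using that unfolding unit_cell_def interior_cbox mem_box_cart abs_less_iff
      by (auto simp: real_point_def dest!: spec[of _ i])
    then have "\<bar>real_of_int (k $ i - l $ i)\<bar> < 1" by linarith
    then show False using i by linarith
  qed
  then show ?thesis by blast
qed

lemma measure_Union_unit_cells:
  assumes "finite A"
  shows "measure lebesgue (\<Union>k\<in>A. unit_cell k) = real (card A)"
proof -
  have "measure lebesgue (\<Union>k\<in>A. unit_cell k) = (\<Sum>k\<in>A. measure lebesgue (unit_cell k))"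
  proof (rule measure_negligible_finite_Union_image[OF assms])
    show "unit_cell k \<in> lmeasurable" for k :: "int^'n" by (simp add: unit_cell_def)
    show "pairwise (\<lambda>k l. negligible (unit_cell k \<inter> unit_cell l)) A"
    proof (rule pairwiseI)
      fix k l assume "k \<noteq> (l::int^'n)"
      then show "negligible (unit_cell k \<inter> unit_cell l)"
        using interiors_unit_cells_disjoint[of k l]
        by (subst negligible_convex_interior) (auto simp: unit_cell_def convex_Int)
    qed
  qed
  then show ?thesis by (simp add: measure_unit_cell)
qed

text \<open>The cells of the points in the ball of radius \<open>m\<close> cover the concentric ball
  of radius \<open>m - n\<close> and stay within radius \<open>m + n\<close>.\<close>

lemma card_lattice_ball_bounds:
  fixes m :: nat
  defines "C \<equiv> real (card (lattice_ball m :: (int ^ 'n) set))" and "n \<equiv> CARD('n)"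
  assumes m: "n \<le> m"
  shows "unit_ball_vol n * (real m - real n) ^ n \<le> C" and "C \<le> unit_ball_vol n * (real m + real n + 1) ^ n"
proof -
  let ?U = "\<Union>k\<in>lattice_ball m. unit_cell (k :: int ^ 'n)"
  have U: "?U \<in> lmeasurable"
    by (intro fmeasurable.finite_UN finite_lattice_ball) (simp add: unit_cell_def)
  have "ball 0 (real m - real n) \<subseteq> ?U"
  proof
    fix x :: "real ^ 'n" assume x: "x \<in> ball 0 (real m - real n)"
    obtain k where k: "x \<in> unit_cell k" using exists_unit_cell by blast
    have "norm (real_point k) \<le> norm x + norm (x - real_point k)"
      using norm_triangle_ineq4[of x "x - real_point k"] by simp
    then have "k \<in> lattice_ball m" using norm_diff_unit_cell[OF k] x by (simp add: lattice_ball_def n_def)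
    then show "x \<in> ?U" using k by blast
  qed
  then have "measure lebesgue (ball (0 :: real ^ 'n) (real m - real n)) \<le> measure lebesgue ?U"
    by (intro measure_mono_fmeasurable U) auto
  then show "unit_ball_vol n * (real m - real n) ^ n \<le> C"
    using m by (simp add: measure_Union_unit_cells finite_lattice_ball content_ball C_def n_def)
  \<comment> \<open>The added 1 turns \<open>norm x \<le> m + n\<close> into the strict inequality
    of an open ball.\<close>
  have "?U \<subseteq> ball 0 (real m + real n + 1)"
  proof
    fix x :: "real ^ 'n" assume "x \<in> ?U"
    then obtain k where k: "x \<in> unit_cell k" "k \<in> lattice_ball m" by blast
    have "norm x \<le> norm (real_point k) + norm (x - real_point k)"
      using norm_triangle_ineq[of "real_point k" "x - real_point k"] by simp
    then show "x \<in> ball 0 (real m + real n + 1)"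
      using norm_diff_unit_cell[OF k(1)] k(2) by (simp add: lattice_ball_def n_def)
  qed
  then have "measure lebesgue ?U \<le> measure lebesgue (ball (0 :: real ^ 'n) (real m + real n + 1))"
    using U by (intro measure_mono_fmeasurable) (auto dest: fmeasurableD)
  then show "C \<le> unit_ball_vol n * (real m + real n + 1) ^ n"
    by (simp add: measure_Union_unit_cells finite_lattice_ball content_ball C_def n_def)
qed

lemma card_lattice_ball_asymp:
  "(\<lambda>m. real (card (lattice_ball m :: (int ^ 'n) set)) / real m ^ CARD('n)) \<longlonglongrightarrow> unit_ball_vol CARD('n)"
proof -
  let ?n = "CARD('n)" and ?V = "unit_ball_vol (real CARD('n))"
  \<comment> \<open>Written with \<open>+ -\<close> so that \<open>power_shift_ratio_limit\<close>
    covers both sides of the sandwich.\<close>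
  have l1: "(\<lambda>m. ?V * ((real m + - real ?n) / real m) ^ ?n) \<longlonglongrightarrow> ?V * 1"
    by (intro tendsto_intros power_shift_ratio_limit)
  have l2: "(\<lambda>m. ?V * ((real m + (real ?n + 1)) / real m) ^ ?n) \<longlonglongrightarrow> ?V * 1"
    by (intro tendsto_intros power_shift_ratio_limit)
  have "(\<lambda>m. real (card (lattice_ball m :: (int ^ 'n) set)) / real m ^ ?n) \<longlonglongrightarrow> ?V * 1"
  proof (rule real_tendsto_sandwich[OF _ _ l1 l2])
    show "\<forall>\<^sub>F m in sequentially. ?V * ((real m + - real ?n) / real m) ^ ?n
        \<le> real (card (lattice_ball m :: (int ^ 'n) set)) / real m ^ ?n"
      using eventually_ge_at_top[of ?n]
    proof eventually_elim
      case (elim m)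
      then show ?case using card_lattice_ball_bounds(1)[where 'n = 'n, OF elim]
        by (simp add: power_divide divide_right_mono)
    qed
    show "\<forall>\<^sub>F m in sequentially. real (card (lattice_ball m :: (int ^ 'n) set)) / real m ^ ?n
        \<le> ?V * ((real m + (real ?n + 1)) / real m) ^ ?n"
      using eventually_ge_at_top[of ?n]
    proof eventually_elim
      case (elim m)
      then show ?case using card_lattice_ball_bounds(2)[where 'n = 'n, OF elim]
        by (simp add: power_divide divide_right_mono add.assoc)
    qed
  qed
  then show ?thesis by simp
qed

text \<open>The cone over the unit sphere is the closed unit ball without its centre, and a single
  point is null.\<close>

lemma sphere_surface_measure_unit_sphere:
  "sphere_surface_measure (sphere (0 :: 'a::euclidean_space) 1) = real DIM('a) * unit_ball_vol DIM('a)"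
proof -
  have "{t *\<^sub>R x | t x. 0 < t \<and> t \<le> 1 \<and> x \<in> sphere (0::'a) 1} = cball 0 1 - {0}"
  proof (intro equalityI subsetI)
    fix y :: 'a assume y: "y \<in> cball 0 1 - {0}"
    then have "y = norm y *\<^sub>R (y /\<^sub>R norm y) \<and> 0 < norm y \<and> norm y \<le> 1 \<and> y /\<^sub>R norm y \<in> sphere 0 1"
      by simp
    then show "y \<in> {t *\<^sub>R x | t x. 0 < t \<and> t \<le> 1 \<and> x \<in> sphere (0::'a) 1}" by blast
  qed auto
  moreover have "measure lebesgue (cball (0::'a) 1 - {0}) = measure lebesgue (cball (0::'a) 1)"
    by (rule measure_negligible_symdiff) (auto intro: negligible_subset[of "{0}"])
  moreover have "measure lebesgue (cball (0::'a) 1) = unit_ball_vol DIM('a)"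
    using content_cball[of 1 "0::'a"] by simp
  ultimately show ?thesis by (simp add: sphere_surface_measure_def)
qed

section \<open>The lattice sum and its logarithmic growth\<close>

definition lattice_sum :: "'n::finite itself \<Rightarrow> nat \<Rightarrow> real" where
  "lattice_sum _ m = (\<Sum>k \<in> lattice_ball m - {0 :: int ^ 'n}. 1 / norm (real_point k) ^ CARD('n))"

lemma lattice_ball_mono: "l \<le> m \<Longrightarrow> lattice_ball l \<subseteq> lattice_ball m"
  by (auto simp: lattice_ball_def)

lemma zero_in_lattice_ball: "0 \<in> lattice_ball m"
  by (simp add: lattice_ball_def)

text \<open>A point entering between radii \<open>m\<close> and \<open>m + 1\<close> has its norm in
  that range, so its term lies between \<open>1 / (m + 1) ^ n\<close> and
  \<open>1 / m ^ n\<close>.\<close>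

lemma lattice_sum_Suc_bounds:
  defines "D \<equiv> \<lambda>m. real (card (lattice_ball (Suc m) :: (int ^ 'n) set)) - real (card (lattice_ball m :: (int ^ 'n) set))"
  shows "D m / real (Suc m) ^ CARD('n) \<le> lattice_sum TYPE('n) (Suc m) - lattice_sum TYPE('n) m"
    and "1 \<le> m \<Longrightarrow> lattice_sum TYPE('n) (Suc m) - lattice_sum TYPE('n) m \<le> D m / real m ^ CARD('n)"
proof -
  let ?S = "lattice_ball (Suc m) - lattice_ball m :: (int ^ 'n) set"
  let ?f = "\<lambda>k :: int ^ 'n. 1 / norm (real_point k) ^ CARD('n)"
  have D: "D m = real (card ?S)"
    using lattice_ball_mono[of m "Suc m", where 'a = 'n]
      card_mono[OF finite_lattice_ball lattice_ball_mono[of m "Suc m", where 'a = 'n]]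
    by (simp add: D_def card_Diff_subset finite_lattice_ball of_nat_diff)
  have "lattice_ball (Suc m) - {0} = ?S \<union> (lattice_ball m - {0})"
    using lattice_ball_mono[of m "Suc m"] zero_in_lattice_ball[of m] by auto
  then have s: "lattice_sum TYPE('n) (Suc m) - lattice_sum TYPE('n) m = sum ?f ?S"
    unfolding lattice_sum_def by (subst \<open>lattice_ball (Suc m) - {0} = _\<close>, subst sum.union_disjoint)
       (auto simp: finite_lattice_ball)
  have "1 / real (Suc m) ^ CARD('n) \<le> ?f k" if "k \<in> ?S" for k
  proof -
    have "k \<noteq> 0" using that zero_in_lattice_ball by auto
    then have "0 < norm (real_point k)" using norm_real_point_ge_1 by force
    moreover have "norm (real_point k) \<le> real (Suc m)" using that by (simp add: lattice_ball_def)
    ultimately show ?thesis by (intro divide_left_mono power_mono) auto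
  qed
  then have "(\<Sum>k\<in>?S. 1 / real (Suc m) ^ CARD('n)) \<le> sum ?f ?S" by (rule sum_mono)
  then show "D m / real (Suc m) ^ CARD('n) \<le> lattice_sum TYPE('n) (Suc m) - lattice_sum TYPE('n) m"
    by (simp add: D s)
  \<comment> \<open>For \<open>m = 0\<close> the right-hand side would be 0 by division by zero,
    while the points of norm 1 make the left-hand side positive.\<close>
  assume m: "1 \<le> m"
  have "?f k \<le> 1 / real m ^ CARD('n)" if "k \<in> ?S" for k
  proof -
    have "real m < norm (real_point k)" using that by (simp add: lattice_ball_def)
    moreover have "0 < norm (real_point k)" using calculation of_nat_0_le_iff[of m] by linarith
    ultimately show ?thesis using m by (intro divide_left_mono power_mono) auto
  qed
  then have "sum ?f ?S \<le> (\<Sum>k\<in>?S. 1 / real m ^ CARD('n))" by (rule sum_mono)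
  then show "lattice_sum TYPE('n) (Suc m) - lattice_sum TYPE('n) m \<le> D m / real m ^ CARD('n)"
    by (simp add: D s)
qed

text \<open>
  Thin shells need not have the expected number of points. Subtracting \<open>c\<close>, the ratio of the number
  of lattice points to \<open>m\<^sup>n\<close>, amounts to a summation by parts: the increments of \<open>G\<close> involve
  only the number of points of full balls, and the Stolz-Cesaro theorem applies.
\<close>

lemma lattice_sum_asymp:
  "(\<lambda>m. lattice_sum TYPE('n::finite) m / ln (real m)) \<longlonglongrightarrow> real CARD('n) * unit_ball_vol CARD('n)"
proof -
  let ?n = "CARD('n)" and ?V = "unit_ball_vol (real CARD('n))" and ?E = "lattice_sum TYPE('n)"
  define C where "C m = real (card (lattice_ball m :: (int ^ 'n) set))" for m
  define c where "c m = C m / real m ^ ?n" for m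
  define G where "G m = ?E m - c m" for m
  define \<delta> where "\<delta> m = 1 / real m ^ ?n - 1 / real (Suc m) ^ ?n" for m
  define h where "h m = ln (real (Suc m)) - ln (real m)" for m
  have c: "c \<longlonglongrightarrow> ?V" unfolding c_def C_def by (rule card_lattice_ball_asymp)
  \<comment> \<open>The logarithm grows by about \<open>1 / m\<close>, the same order as the
    increments of \<open>G\<close>.\<close>
  have h: "(\<lambda>m. 1 / (real m * h m)) \<longlonglongrightarrow> 1" unfolding h_def by real_asymp
  have hpos: "h m > 0" if "m \<ge> 1" for m using that by (simp add: h_def)
  have l1: "(\<lambda>m. c m * (real m * (1 - (real m / (real m + 1)) ^ ?n)) * (1 / (real m * h m))) \<longlonglongrightarrow> ?V * real ?n * 1"
    by (intro tendsto_mult c h power_ratio_limit)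
  have l2: "(\<lambda>m. c (Suc m) * ((real m + 1) / real m) ^ ?n * (real m * (1 - (real m / (real m + 1)) ^ ?n)) * (1 / (real m * h m)))
      \<longlonglongrightarrow> ?V * 1 * real ?n * 1"
    by (intro tendsto_mult h power_ratio_limit power_shift_ratio_limit LIMSEQ_Suc[OF c])
  have "(\<lambda>m. (G (Suc m) - G m) / h m) \<longlonglongrightarrow> ?V * real ?n * 1"
  proof (rule real_tendsto_sandwich[OF _ _ l1])
    show "\<forall>\<^sub>F m in sequentially. c m * (real m * (1 - (real m / (real m + 1)) ^ ?n)) * (1 / (real m * h m))
        \<le> (G (Suc m) - G m) / h m"
      using eventually_ge_at_top[of 1]
    proof eventually_elim
      case (elim m)
      have "1 - (real m / (real m + 1)) ^ ?n = real m ^ ?n * \<delta> m"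
        using elim by (simp add: \<delta>_def power_divide field_simps)
      then have "c m * (real m * (1 - (real m / (real m + 1)) ^ ?n)) * (1 / (real m * h m)) = C m * \<delta> m / h m"
        using elim by (simp add: c_def)
      \<comment> \<open>Summation by parts: the count of the larger ball cancels against
        \<open>c (Suc m)\<close>, which leaves only the smaller ball. In the upper bound the larger
        ball remains instead.\<close>
      also have "C m * \<delta> m = (C (Suc m) - C m) / real (Suc m) ^ ?n - c (Suc m) + c m"
        by (simp add: c_def \<delta>_def field_simps)
      also have "\<dots> \<le> G (Suc m) - G m"
        using lattice_sum_Suc_bounds(1)[where 'n = 'n, of m] by (simp add: G_def C_def)
      finally show ?case using hpos[OF elim] by (simp add: divide_right_mono)
    qed
    show "\<forall>\<^sub>F m in sequentially. (G (Suc m) - G m) / h m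
        \<le> c (Suc m) * ((real m + 1) / real m) ^ ?n * (real m * (1 - (real m / (real m + 1)) ^ ?n)) * (1 / (real m * h m))"
      using eventually_ge_at_top[of 1]
    proof eventually_elim
      case (elim m)
      have "G (Suc m) - G m \<le> (C (Suc m) - C m) / real m ^ ?n - c (Suc m) + c m"
        using lattice_sum_Suc_bounds(2)[where 'n = 'n, OF elim] by (simp add: G_def C_def)
      also have "\<dots> = C (Suc m) * \<delta> m"
        by (simp add: c_def \<delta>_def right_diff_distrib diff_divide_distrib)
      finally have "(G (Suc m) - G m) / h m \<le> C (Suc m) * \<delta> m / h m"
        using hpos[OF elim] by (simp add: divide_right_mono)
      also have "\<dots> = c (Suc m) * ((real m + 1) / real m) ^ ?n * (real m * (1 - (real m / (real m + 1)) ^ ?n)) * (1 / (real m * h m))"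
      proof -
        have "1 - (real m / (real m + 1)) ^ ?n = real m ^ ?n * \<delta> m"
          using elim by (simp add: \<delta>_def power_divide field_simps)
        moreover have "c (Suc m) * ((real m + 1) / real m) ^ ?n = C (Suc m) / real m ^ ?n"
          using elim by (simp add: c_def power_divide add.commute)
        ultimately show ?thesis using elim by simp
      qed
      finally show ?case .
    qed
    show "(\<lambda>m. c (Suc m) * ((real m + 1) / real m) ^ ?n * (real m * (1 - (real m / (real m + 1)) ^ ?n)) * (1 / (real m * h m)))
      \<longlonglongrightarrow> ?V * real ?n * 1" using l2 by simp
  qed
  \<comment> \<open>The index is shifted by one because \<open>ln 0\<close> has only a default
    value, whereas Stolz-Cesaro wants increasing denominators from the start.\<close>
  then have "(\<lambda>m. (G (Suc (Suc m)) - G (Suc m)) / (ln (real (Suc (Suc m))) - ln (real (Suc m)))) \<longlonglongrightarrow> ?V * real ?n"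
    unfolding h_def by (subst (asm) filterlim_sequentially_Suc[symmetric]) simp
  moreover have "filterlim (\<lambda>m. ln (real (Suc m))) at_top sequentially" by real_asymp
  moreover have "ln (real (Suc m)) < ln (real (Suc (Suc m)))" for m by simp
  ultimately have "(\<lambda>m. G (Suc m) / ln (real (Suc m))) \<longlonglongrightarrow> ?V * real ?n"
    using stolz_cesaro[of "\<lambda>m. ln (real (Suc m))" "\<lambda>m. G (Suc m)" "?V * real ?n"] by blast
  then have "(\<lambda>m. G m / ln (real m)) \<longlonglongrightarrow> ?V * real ?n"
    by (subst (asm) filterlim_sequentially_Suc)
  \<comment> \<open>As \<open>c\<close> converges, adding it back to \<open>G\<close> is negligible
    after division by the logarithm.\<close>
  moreover have "(\<lambda>m. 1 / ln (real m)) \<longlonglongrightarrow> 0" by real_asymp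
  ultimately have "(\<lambda>m. G m / ln (real m) + c m * (1 / ln (real m))) \<longlonglongrightarrow> ?V * real ?n + ?V * 0"
    by (intro tendsto_intros c)
  then show ?thesis by (simp add: G_def diff_divide_distrib mult.commute)
qed

section \<open>The extremal constant on the grid\<close>

text \<open>On the diagonal this is \<open>1 / 0\<close>, hence 0, as the locale demands. Only the
  difference enters, so every row is a translate of one function on the lattice.\<close>

definition hls_kernel :: "int ^ 'n::finite \<Rightarrow> int ^ 'n \<Rightarrow> real" where
  "hls_kernel r s = 1 / norm (real_point (r - s)) ^ CARD('n)"

lemma finite_grid: "finite (grid N)"
  unfolding grid_def by (rule finite_int_box)

lemma card_grid: "card (grid N :: (int ^ 'n) set) = N ^ CARD('n)"
  unfolding grid_def card_int_box by simp

lemma pos_kernel_hls: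
  assumes "1 \<le> N"
  shows "pos_kernel (grid N :: (int ^ 'n::finite) set) hls_kernel"
proof
  have "card (grid N :: (int ^ 'n) set) \<noteq> 0" using assms by (simp add: card_grid)
  then show "grid N \<noteq> ({} :: (int ^ 'n) set)" by auto
  show "hls_kernel r s = hls_kernel s r" for r s :: "int ^ 'n"
    by (simp add: hls_kernel_def real_point_diff norm_minus_commute)
  show "0 < hls_kernel r s" if "r \<noteq> s" for r s :: "int ^ 'n"
    using norm_real_point_ge_1[of "r - s"] that by (auto simp: hls_kernel_def intro!: zero_less_power)
qed (simp_all add: finite_grid hls_kernel_def)

lemma hls_form_eq: "hls_form N a b = (\<Sum>r\<in>grid N. \<Sum>s\<in>grid N. hls_kernel r s * a r * b s)"
proof -
  have "(\<Sum>r\<in>grid N. \<Sum>s\<in>grid N. hls_kernel r s * a r * b s)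
      = (\<Sum>(r, s)\<in>grid N \<times> grid N. hls_kernel r s * a r * b s)"
    by (rule sum.cartesian_product)
  also have "\<dots> = hls_form N a b"
    unfolding hls_form_def
    by (rule sum.mono_neutral_cong_right) (auto simp: finite_grid hls_kernel_def real_point_diff)
  finally show ?thesis by simp
qed

text \<open>\<open>GREATEST\<close> is meaningful only once a greatest value is shown to exist; the
  abstract maximizer supplies it, at a pair of equal nonnegative vectors. The final bound ranges
  over all functions, extensional or not.\<close>

lemma hls_maximizer:
  assumes N: "1 \<le> N"
  obtains v :: "int ^ 'n::finite \<Rightarrow> real"
  where "v \<in> nonneg_vecs N" "grid_norm N v = 1" "hls_form N v v = hls_const TYPE('n) N"
    "\<forall>a b :: int ^ 'n \<Rightarrow> real. hls_form N a b \<le> hls_const TYPE('n) N * grid_norm N a * grid_norm N b"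
proof -
  interpret pos_kernel "grid N :: (int ^ 'n) set" hls_kernel by (rule pos_kernel_hls[OF N])
  have form: "hls_form N a b = bform a b" for a b
    by (simp add: hls_form_eq bform_def)
  obtain v where v: "v \<in> grid N \<rightarrow>\<^sub>E {0..}" "sq v = 1"
      "\<And>a b. bform a b \<le> bform v v * L2_set a (grid N) * L2_set b (grid N)"
    using exists_maximizer by blast
  have "hls_const TYPE('n) N = bform v v"
    unfolding hls_const_def form grid_norm_def
  proof (rule Greatest_equality)
    show "\<exists>a\<in>grid_vecs N. \<exists>b\<in>grid_vecs N.
        L2_set a (grid N) = 1 \<and> L2_set b (grid N) = 1 \<and> bform v v = bform a b"
      using v by (intro bexI[of _ v] conjI) (auto simp: grid_vecs_def L2_set_eq_1_iff)
    fix y assume "\<exists>a\<in>grid_vecs N. \<exists>b\<in>grid_vecs N.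
        L2_set a (grid N) = 1 \<and> L2_set b (grid N) = 1 \<and> y = bform a b"
    then obtain a b where "L2_set a (grid N) = 1" "L2_set b (grid N) = 1" "y = bform a b" by blast
    then show "y \<le> bform v v" using v(3)[of a b] by simp
  qed
  then show ?thesis
    using that[of v] v by (simp add: form nonneg_vecs_def grid_norm_def L2_set_eq_1_iff)
qed

section \<open>The extremal pair\<close>

text \<open>For n = 1 and N = 2 the form is \<open>a 1 * b 2 + a 2 * b 1\<close> with maximum 1, and
  every nonnegative unit vector paired with its swap attains it. Uniqueness fails there, which is
  why this case is excluded from it.\<close>

lemma hls_extremal_uniqueness:
  assumes N: "1 \<le> N"
  shows "\<exists>v\<in>pos_vecs N. (v, v) \<in> (extremal_pairs N :: ((int ^ 'n::finite \<Rightarrow> real) \<times> _) set) \<and>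
    (\<not> (CARD('n) = 1 \<and> N = 2) \<longrightarrow> (\<exists>!p. p \<in> (extremal_pairs N :: ((int ^ 'n \<Rightarrow> real) \<times> _) set)))"
proof -
  interpret pos_kernel "grid N :: (int ^ 'n) set" hls_kernel by (rule pos_kernel_hls[OF N])
  let ?lam = "hls_const TYPE('n) N"
  have form: "hls_form N a b = bform a b" for a b
    by (simp add: hls_form_eq bform_def)
  obtain v :: "int ^ 'n \<Rightarrow> real"
    where v: "v \<in> nonneg_vecs N" "grid_norm N v = 1" "hls_form N v v = ?lam"
    "\<forall>a b :: int ^ 'n \<Rightarrow> real. hls_form N a b \<le> ?lam * grid_norm N a * grid_norm N b"
    using hls_maximizer[OF N, where 'n = 'n] by blast
  have bound: "bform a b \<le> ?lam * L2_set a (grid N) * L2_set b (grid N)" for a b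
    using v(4) by (simp add: form grid_norm_def)
  have sv: "sq v = 1" "bform v v = ?lam" "\<And>r. r \<in> grid N \<Longrightarrow> 0 \<le> v r"
    using v(1-3) by (auto simp: form grid_norm_def L2_set_eq_1_iff nonneg_vecs_def)
  have "app v r = ?lam * v r" if "r \<in> grid N" for r
    using extremal_imp_eigenvector[OF bound, of v v r] sv that by simp
  then have "0 < v r" if "r \<in> grid N" for r
    using nonneg_eigenvector_pos[of v ?lam r] sv that by simp
  then have vpos: "v \<in> pos_vecs N" using v(1) by (auto simp: nonneg_vecs_def pos_vecs_def PiE_iff)
  have vv: "(v, v) \<in> extremal_pairs N" using v by (simp add: extremal_pairs_def)
  have "p = (v, v)" if p: "p \<in> extremal_pairs N" and exc: "\<not> (CARD('n) = 1 \<and> N = 2)" for p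
  proof -
    obtain a b where "p = (a, b)" "a \<in> nonneg_vecs N" "b \<in> nonneg_vecs N"
        "L2_set a (grid N) = 1" "L2_set b (grid N) = 1" "bform a b = ?lam"
      using p by (auto simp: extremal_pairs_def form grid_norm_def)
    then have ab: "p = (a, b)" "a \<in> nonneg_vecs N" "b \<in> nonneg_vecs N"
        "sq a = 1" "sq b = 1" "bform a b = ?lam"
      by (simp_all add: L2_set_eq_1_iff)
    have nn: "0 \<le> a r" "0 \<le> b r" if "r \<in> grid N" for r
      using ab that by (auto simp: nonneg_vecs_def)
    have "a r = v r \<and> b r = v r" if r: "r \<in> grid N" for r
    proof (cases "N = 1")
      case True
      then have "card (grid N :: (int ^ 'n) set) = 1" by (simp add: card_grid)
      then have g: "grid N = {r}" using r by (auto simp: card_1_singleton_iff)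
      have "x r = 1" if "sq x = 1" "0 \<le> x r" for x
      proof -
        have "sq x = (x r)\<^sup>2" unfolding sq_def unfolding g by simp
        then show ?thesis using that by (auto simp: power2_eq_1_iff)
      qed
      then show ?thesis using ab sv nn r by metis
    next
      case False
      have "3 \<le> N ^ CARD('n)"
      proof (cases "N = 2")
        case True
        then have "2 \<le> CARD('n)" using exc by (metis One_nat_def Suc_leI le_neq_implies_less numeral_2_eq_2 zero_less_card_finite)
        then have "2 ^ 2 \<le> (2::nat) ^ CARD('n)" by (intro power_increasing) auto
        then show ?thesis using True by simp
      next
        case F: False
        then have "N ^ 1 \<le> N ^ CARD('n)" using N by (intro power_increasing) (auto simp: Suc_leI)
        then show ?thesis using N F False by simp
      qed
      then have eq: "a s = b s" if "s \<in> grid N" for s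
        using extremal_pair_diagonal[OF bound _ ab(4-6) that] by (simp add: card_grid)
      then have "bform a b = bform a a" by (intro bform_cong) auto
      then have "a r = v r"
        using extremal_vector_unique[OF bound ab(4) _ nn(1) sv r] ab(6) by simp
      then show ?thesis using eq[OF r] by simp
    qed
    then have "a = v" "b = v" using ab(2,3) v(1) unfolding nonneg_vecs_def
      by (auto intro: PiE_ext)
    then show ?thesis using ab(1) by simp
  qed
  then show ?thesis using vpos vv by (intro bexI[of _ v]) auto
qed

section \<open>Bounds for the constant and their asymptotics\<close>

text \<open>Schur test, each row being bounded by a full lattice ball: the differences
  \<open>r - s\<close> have coordinates at most \<open>N\<close> in modulus, hence norm at most
  \<open>n * N\<close> through the l1 norm.\<close>

lemma hls_const_le:
  assumes N: "1 \<le> N"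
  shows "hls_const TYPE('n::finite) N \<le> lattice_sum TYPE('n) (CARD('n) * N)"
proof -
  interpret pos_kernel "grid N :: (int ^ 'n) set" hls_kernel by (rule pos_kernel_hls[OF N])
  obtain v :: "int ^ 'n \<Rightarrow> real" where v: "grid_norm N v = 1" "hls_form N v v = hls_const TYPE('n) N"
    using hls_maximizer[OF N, where 'n = 'n] by metis
  have "bform v v \<le> lattice_sum TYPE('n) (CARD('n) * N) * sq v"
  proof (rule schur_test)
    fix r :: "int ^ 'n" assume r: "r \<in> grid N"
    have sub: "(\<lambda>s. r - s) ` (grid N - {r}) \<subseteq> lattice_ball (CARD('n) * N) - {0}"
    proof
      fix k assume "k \<in> (\<lambda>s. r - s) ` (grid N - {r})"
      then obtain s where s: "s \<in> grid N" "s \<noteq> r" "k = r - s" by blast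
      have "\<bar>real_point k $ i\<bar> \<le> real N" for i
      proof -
        have "1 \<le> r $ i \<and> r $ i \<le> int N" "1 \<le> s $ i \<and> s $ i \<le> int N" using r s by (auto simp: grid_def)
        then show ?thesis by (simp add: real_point_def s(3) abs_le_iff)
      qed
      then have "(\<Sum>i\<in>UNIV. \<bar>real_point k $ i\<bar>) \<le> (\<Sum>i\<in>(UNIV::'n set). real N)" by (intro sum_mono)
      then have "norm (real_point k) \<le> real (CARD('n) * N)"
        using norm_le_l1_cart[of "real_point k"] by simp
      then show "k \<in> lattice_ball (CARD('n) * N) - {0}" using s by (simp add: lattice_ball_def)
    qed
    have "(\<Sum>s\<in>grid N. hls_kernel r s) = (\<Sum>s\<in>grid N - {r}. 1 / norm (real_point (r - s)) ^ CARD('n))"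
      using r by (simp add: sum.remove[OF finite_grid] diag) (simp add: hls_kernel_def)
    also have "\<dots> = (\<Sum>k\<in>(\<lambda>s. r - s) ` (grid N - {r}). 1 / norm (real_point k) ^ CARD('n))"
      by (subst sum.reindex) (auto simp: inj_on_def)
    also have "\<dots> \<le> lattice_sum TYPE('n) (CARD('n) * N)"
      unfolding lattice_sum_def by (rule sum_mono2[OF _ sub]) (auto simp: finite_lattice_ball)
    finally show "(\<Sum>s\<in>grid N. hls_kernel r s) \<le> lattice_sum TYPE('n) (CARD('n) * N)" .
  qed
  then show ?thesis
    using v by (simp add: hls_form_eq bform_def grid_norm_def L2_set_eq_1_iff)
qed

text \<open>Test with the constant vector 1, of squared norm \<open>N ^ n\<close>. Only rows whose
  point has the whole ball of radius \<open>M\<close> around it inside the grid are counted; the box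
  of such points used here has side \<open>N - 2 * M\<close>.\<close>

lemma hls_const_ge:
  assumes N: "1 \<le> N" and M: "2 * M \<le> N"
  shows "(real N - 2 * real M) ^ CARD('n) * lattice_sum TYPE('n::finite) M
    \<le> real N ^ CARD('n) * hls_const TYPE('n) N"
proof -
  interpret pos_kernel "grid N :: (int ^ 'n) set" hls_kernel by (rule pos_kernel_hls[OF N])
  define I where "I = {r :: int ^ 'n. \<forall>i. int M + 1 \<le> r $ i \<and> r $ i \<le> int N - int M}"
  let ?one = "\<lambda>_ :: int ^ 'n. 1 :: real"
  have "real (card I) = (real N - 2 * real M) ^ CARD('n)"
    unfolding I_def card_int_box using M by (simp add: of_nat_diff)
  have "1 \<le> r $ i \<and> r $ i \<le> int N"
    if "\<forall>i. int M + 1 \<le> r $ i \<and> r $ i \<le> int N - int M" for r :: "int ^ 'n" and i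
    using spec[OF that, of i] by linarith
  then have IS: "I \<subseteq> grid N" by (auto simp: I_def grid_def)
  have row: "lattice_sum TYPE('n) M \<le> (\<Sum>s\<in>grid N. hls_kernel r s)" if r: "r \<in> I" for r
  proof -
    have sub: "(\<lambda>k. r - k) ` (lattice_ball M - {0}) \<subseteq> grid N"
    proof
      fix s assume "s \<in> (\<lambda>k. r - k) ` (lattice_ball M - {0})"
      then obtain k where k: "s = r - k" "k \<in> lattice_ball M" by blast
      have "1 \<le> s $ i \<and> s $ i \<le> int N" for i
      proof -
        have "\<bar>k $ i\<bar> \<le> int M"
          using abs_le_norm_real_point[of k i] k(2) by (simp add: lattice_ball_def)
        moreover have "int M + 1 \<le> r $ i \<and> r $ i \<le> int N - int M" using r by (simp add: I_def)
        ultimately show ?thesis unfolding k(1) vector_minus_component by linarith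
      qed
      then show "s \<in> grid N" by (simp add: grid_def)
    qed
    have "lattice_sum TYPE('n) M = (\<Sum>s\<in>(\<lambda>k. r - k) ` (lattice_ball M - {0}). hls_kernel r s)"
      unfolding lattice_sum_def by (subst sum.reindex) (auto simp: inj_on_def hls_kernel_def)
    also have "\<dots> \<le> (\<Sum>s\<in>grid N. hls_kernel r s)"
      by (rule sum_mono2[OF finite_grid sub]) (simp add: hls_kernel_def)
    finally show ?thesis .
  qed
  have "real (card I) * lattice_sum TYPE('n) M \<le> (\<Sum>r\<in>I. \<Sum>s\<in>grid N. hls_kernel r s)"
    using sum_mono[of I "\<lambda>_. lattice_sum TYPE('n) M", OF row] by simp
  also have "\<dots> \<le> (\<Sum>r\<in>grid N. \<Sum>s\<in>grid N. hls_kernel r (s :: int ^ 'n))"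
    using IS by (intro sum_mono2 finite_grid sum_nonneg) (auto simp: hls_kernel_def)
  also have "\<dots> = hls_form N ?one ?one" by (simp add: hls_form_eq)
  also have "\<dots> \<le> hls_const TYPE('n) N * grid_norm N ?one * grid_norm N ?one"
    using hls_maximizer[OF N, where 'n = 'n] by blast
  also have "\<dots> = real N ^ CARD('n) * hls_const TYPE('n) N"
    by (simp add: grid_norm_def L2_set_def card_grid)
  finally show ?thesis using \<open>real (card I) = _\<close> by simp
qed

lemma hls_const_asymp:
  "(\<lambda>N. hls_const TYPE('n::finite) N / ln (real N))
     \<longlonglongrightarrow> sphere_surface_measure (sphere (0 :: real ^ 'n) 1)"
proof -
  let ?n = "CARD('n)" and ?E = "lattice_sum TYPE('n)"
  define c where "c = real ?n * unit_ball_vol (real ?n)"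
  \<comment> \<open>\<open>M\<close> must be small against \<open>N\<close>, so that the discarded
    boundary rows are negligible, yet \<open>ln M\<close> must be asymptotic to
    \<open>ln N\<close>.\<close>
  define M where "M N = nat \<lfloor>real N / ln (real N)\<rfloor>" for N
  have lim: "(\<lambda>m. ?E m / ln (real m)) \<longlonglongrightarrow> c" unfolding c_def by (rule lattice_sum_asymp)
  have M_top: "filterlim M at_top sequentially" unfolding M_def by real_asymp
  have M_ln: "(\<lambda>N. ln (real (M N)) / ln (real N)) \<longlonglongrightarrow> 1" unfolding M_def by real_asymp
  have M_small: "(\<lambda>N. real (M N) / real N) \<longlonglongrightarrow> 0" unfolding M_def by real_asymp
  have "filterlim (\<lambda>N. ?n * N) at_top sequentially"
    by (rule filterlim_at_top_mono[OF filterlim_ident]) (simp add: Suc_leI)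
  then have u: "(\<lambda>N. ?E (?n * N) / ln (real (?n * N))) \<longlonglongrightarrow> c"
    by (rule filterlim_compose[OF lim])
  have n: "real ?n > 0" by simp
  \<comment> \<open>The factor n in the radius \<open>n * N\<close> adds only a constant to the
    logarithm, so the limit is unchanged.\<close>
  have "(\<lambda>N. ln (k * real N) / ln (real N)) \<longlonglongrightarrow> 1" if "k > 0" for k :: real using that by real_asymp
  from tendsto_mult[OF u this[OF n]]
  have upper: "(\<lambda>N. ?E (?n * N) / ln (real (?n * N)) * (ln (real ?n * real N) / ln (real N))) \<longlonglongrightarrow> c"
    by simp
  have "(\<lambda>N. (1 - 2 * (real (M N) / real N)) ^ ?n * (?E (M N) / ln (real (M N))) * (ln (real (M N)) / ln (real N)))
      \<longlonglongrightarrow> (1 - 2 * 0) ^ ?n * c * 1"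
    by (intro tendsto_intros M_small M_ln filterlim_compose[OF lim M_top])
  then have lower: "(\<lambda>N. (1 - 2 * (real (M N) / real N)) ^ ?n * (?E (M N) / ln (real (M N))) * (ln (real (M N)) / ln (real N)))
      \<longlonglongrightarrow> c" by simp
  have "(\<lambda>N. hls_const TYPE('n) N / ln (real N)) \<longlonglongrightarrow> c"
  proof (rule real_tendsto_sandwich[OF _ _ lower upper])
    have "\<forall>\<^sub>F N in sequentially. real (M N) / real N < 1 / 2"
      using order_tendstoD(2)[OF M_small, of "1/2"] by simp
    moreover have "\<forall>\<^sub>F N in sequentially. 2 \<le> M N"
      using M_top by (simp add: filterlim_at_top)
    ultimately show "\<forall>\<^sub>F N in sequentially.
        (1 - 2 * (real (M N) / real N)) ^ ?n * (?E (M N) / ln (real (M N))) * (ln (real (M N)) / ln (real N))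
        \<le> hls_const TYPE('n) N / ln (real N)"
      using eventually_ge_at_top[of 2]
    proof eventually_elim
      case (elim N)
      have MN: "2 * M N \<le> N" using elim by (simp add: field_simps)
      have "(1 - 2 * (real (M N) / real N)) ^ ?n = ((real N - 2 * real (M N)) / real N) ^ ?n"
        using elim by (simp add: field_simps)
      then have "(1 - 2 * (real (M N) / real N)) ^ ?n * ?E (M N)
          = (real N - 2 * real (M N)) ^ ?n * ?E (M N) / real N ^ ?n"
        by (simp add: power_divide)
      also have "\<dots> \<le> hls_const TYPE('n) N"
        using hls_const_ge[where 'n = 'n, of N "M N"] MN elim by (simp add: field_simps)
      finally have "(1 - 2 * (real (M N) / real N)) ^ ?n * ?E (M N) / ln (real N) \<le> hls_const TYPE('n) N / ln (real N)"
        using elim by (intro divide_right_mono) auto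
      moreover have "ln (real (M N)) \<noteq> 0" using elim by simp
      ultimately show ?case by simp
    qed
    show "\<forall>\<^sub>F N in sequentially. hls_const TYPE('n) N / ln (real N)
        \<le> ?E (?n * N) / ln (real (?n * N)) * (ln (real ?n * real N) / ln (real N))"
      using eventually_ge_at_top[of 2]
    proof eventually_elim
      case (elim N)
      have "1 \<le> ?n" by (simp add: Suc_leI)
      then have "1 * 2 \<le> ?n * N" using elim by (intro mult_mono) auto
      then have "1 < real (?n * N)" by linarith
      then have "ln (real (?n * N)) \<noteq> 0" using ln_gt_zero by fastforce
      moreover have "hls_const TYPE('n) N / ln (real N) \<le> ?E (?n * N) / ln (real N)"
        using elim hls_const_le[where 'n = 'n, of N] by (intro divide_right_mono) auto
      ultimately show ?case by simp
    qed
  qed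
  then show ?thesis by (simp add: sphere_surface_measure_unit_sphere c_def)
qed

theorem theorem2:
  shows
    "(\<forall>N\<ge>1. \<forall>a \<in> grid_vecs N. \<forall>b \<in> (grid_vecs N :: (int ^ 'n::finite \<Rightarrow> real) set).
        hls_form N a b \<le> hls_const TYPE('n) N * grid_norm N a * grid_norm N b) \<and>
     (\<exists>f g :: nat \<Rightarrow> real. f \<in> o(\<lambda>N. ln (real N)) \<and> g \<in> o(\<lambda>N. ln (real N)) \<and>
        (\<forall>\<^sub>F N in sequentially.
           sphere_surface_measure (sphere (0 :: real ^ 'n) 1) * ln (real N) - f N
             < hls_const TYPE('n) N \<and>
           hls_const TYPE('n) N
             < sphere_surface_measure (sphere (0 :: real ^ 'n) 1) * ln (real N) + g N)) \<and>
     (\<forall>N\<ge>1. \<exists>v \<in> pos_vecs N. (v, v) \<in> (extremal_pairs N :: ((int ^ 'n \<Rightarrow> real) \<times> _) set) \<and>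
        (\<not> (CARD('n) = 1 \<and> N = 2) \<longrightarrow>
           (\<exists>!p. p \<in> (extremal_pairs N :: ((int ^ 'n \<Rightarrow> real) \<times> _) set))))"
proof (intro conjI)
  show "\<forall>N\<ge>1. \<forall>a \<in> grid_vecs N. \<forall>b \<in> (grid_vecs N :: (int ^ 'n::finite \<Rightarrow> real) set).
        hls_form N a b \<le> hls_const TYPE('n) N * grid_norm N a * grid_norm N b"
    using hls_maximizer[where 'n = 'n] by metis
  let ?c = "sphere_surface_measure (sphere (0 :: real ^ 'n) 1)"
  \<comment> \<open>One error term serves both sides: the absolute deviation, plus 1 to make the
    inequalities strict.\<close>
  define f where "f N = \<bar>hls_const TYPE('n) N - ?c * ln (real N)\<bar> + 1" for N
  have ln_nz: "\<forall>\<^sub>F N in sequentially. ln (real N) \<noteq> 0"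
    using eventually_ge_at_top[of 2] by eventually_elim simp
  have "(\<lambda>N. hls_const TYPE('n) N - ?c * ln (real N)) \<in> o(\<lambda>N. ln (real N))"
  proof (rule smalloI_tendsto[OF _ ln_nz])
    have "(\<lambda>N. hls_const TYPE('n) N / ln (real N) - ?c) \<longlonglongrightarrow> ?c - ?c"
      by (intro tendsto_intros hls_const_asymp)
    then show "(\<lambda>N. (hls_const TYPE('n) N - ?c * ln (real N)) / ln (real N)) \<longlonglongrightarrow> 0"
      unfolding diff_self
      by (rule Lim_transform_eventually) (use ln_nz in eventually_elim, simp add: diff_divide_distrib)
  qed
  then have "(\<lambda>N. \<bar>hls_const TYPE('n) N - ?c * ln (real N)\<bar>) \<in> o(\<lambda>N. ln (real N))" by simp
  moreover have "(\<lambda>N. 1) \<in> o(\<lambda>N. ln (real N))" by real_asymp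
  ultimately have "f \<in> o(\<lambda>N. ln (real N))" unfolding f_def by (rule sum_in_smallo)
  moreover have "?c * ln (real N) - f N < hls_const TYPE('n) N \<and> hls_const TYPE('n) N < ?c * ln (real N) + f N" for N
    unfolding f_def by linarith
  ultimately show "\<exists>f g :: nat \<Rightarrow> real. f \<in> o(\<lambda>N. ln (real N)) \<and> g \<in> o(\<lambda>N. ln (real N)) \<and>
        (\<forall>\<^sub>F N in sequentially. ?c * ln (real N) - f N < hls_const TYPE('n) N \<and>
           hls_const TYPE('n) N < ?c * ln (real N) + g N)"
    by (intro exI[of _ f]) simp
  show "\<forall>N\<ge>1. \<exists>v \<in> pos_vecs N. (v, v) \<in> (extremal_pairs N :: ((int ^ 'n \<Rightarrow> real) \<times> _) set) \<and>
        (\<not> (CARD('n) = 1 \<and> N = 2) \<longrightarrow>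
           (\<exists>!p. p \<in> (extremal_pairs N :: ((int ^ 'n \<Rightarrow> real) \<times> _) set)))"
    using hls_extremal_uniqueness by blast
qed

end
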